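(* Let $X$ be a smooth, strictly convex and reflexive Banach space. Let $\alpha\in\mathbb{R}$, let $A:X\rightrightarrows X^*$ be $\alpha$-monotone and let $\gamma>0$ be such that $1+\gamma\alpha>0$. Then: (i) $J_{\gamma A}$ is single-valued. (ii) $\mathrm{dom}\,J_{\gamma A}=X$ if and only if $A$ is maximally $\alpha$-monotone.
   Context: All Banach spaces are real. $J:X\to X^*$ is the normalized duality mapping, $\langle x,Jx\rangle=\|x\|^2=\|Jx\|^2$ (single-valued and bijective here). $A$ is $\alpha$-monotone if $\langle x-y,u-v\rangle\ge\alpha\langle x-y,Jx-Jy\rangle$ for all $(x,u),(y,v)\in\mathrm{gra}\,A$; it is maximally $\alpha$-monotone if moreover no $\alpha$-monotone operator has a graph properly containing $\mathrm{gra}\,A$. The resolvent is $J_{\gamma A}:=(J+\gamma A)^{-1}J:X\rightrightarrows X$, i.e. $a\in J_{\gamma A}x$ iff $Jx\in Ja+\gamma Aa$; $\mathrm{dom}\,T=\{x:Tx\ne\emptyset\}$. "Single-valued" means $J_{\gamma A}x$ contains exactly one element for each $x\in\mathrm{dom}\,J_{\gamma A}$. *)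

theory Defs
  imports "HOL-Analysis.Analysis"
begin

text \<open>The dual space \<open>X\<^sup>*\<close> is the normed space \<^typ>\<open>'a \<Rightarrow>\<^sub>L real\<close> of bounded linear functionals,
  and the pairing \<open>\<langle>x, f\<rangle>\<close> is \<open>blinfun_apply f x\<close>.
  Properties of the space \<open>X\<close> are predicates on types, applied to \<open>TYPE('a)\<close>.\<close>

text \<open>Smoothness is Gateaux differentiability of the norm on the unit sphere (a two-sided limit).\<close>

definition smooth_space :: "'a::real_normed_vector itself \<Rightarrow> bool" where
  "smooth_space _ \<longleftrightarrow>
     (\<forall>x y :: 'a. norm x = 1 \<and> norm y = 1 \<longrightarrow>
        (\<exists>l. ((\<lambda>t. (norm (x + t *\<^sub>R y) - norm x) / t) \<longlongrightarrow> l) (at (0::real))))"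

definition strictly_convex_space :: "'a::real_normed_vector itself \<Rightarrow> bool" where
  "strictly_convex_space _ \<longleftrightarrow>
     (\<forall>x y :: 'a. norm x = 1 \<and> norm y = 1 \<and> x \<noteq> y \<longrightarrow> norm ((1/2) *\<^sub>R (x + y)) < 1)"

definition reflexive_space :: "'a::real_normed_vector itself \<Rightarrow> bool" where
  "reflexive_space _ \<longleftrightarrow>
     (\<forall>\<phi> :: ('a \<Rightarrow>\<^sub>L real) \<Rightarrow>\<^sub>L real. \<exists>x :: 'a. \<forall>f. blinfun_apply \<phi> f = blinfun_apply f x)"

text \<open>In a general normed space a functional as below need not be unique, and the normalized
  duality mapping is set-valued. On a smooth space there is exactly one, so the description
  operator picks it; the definition is meaningful only there.\<close>

definition duality_map :: "'a::real_normed_vector \<Rightarrow> ('a \<Rightarrow>\<^sub>L real)" where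
  "duality_map x =
     (THE f. blinfun_apply f x = (norm x)\<^sup>2 \<and> (norm x)\<^sup>2 = (norm f)\<^sup>2)"

definition graph_of :: "('a \<Rightarrow> 'b set) \<Rightarrow> ('a \<times> 'b) set" where
  "graph_of T = {(x, u). u \<in> T x}"

definition domain_of :: "('a \<Rightarrow> 'b set) \<Rightarrow> 'a set" where
  "domain_of T = {x. T x \<noteq> {}}"

definition single_valued_op :: "('a \<Rightarrow> 'b set) \<Rightarrow> bool" where
  "single_valued_op T \<longleftrightarrow> (\<forall>x \<in> domain_of T. \<exists>!a. a \<in> T x)"

definition alpha_monotone ::
    "real \<Rightarrow> ('a::real_normed_vector \<Rightarrow> ('a \<Rightarrow>\<^sub>L real) set) \<Rightarrow> bool" where
  "alpha_monotone \<alpha> A \<longleftrightarrow>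
     (\<forall>(x, u) \<in> graph_of A. \<forall>(y, v) \<in> graph_of A.
        blinfun_apply (u - v) (x - y)
          \<ge> \<alpha> * blinfun_apply (duality_map x - duality_map y) (x - y))"

definition maximally_alpha_monotone ::
    "real \<Rightarrow> ('a::real_normed_vector \<Rightarrow> ('a \<Rightarrow>\<^sub>L real) set) \<Rightarrow> bool" where
  "maximally_alpha_monotone \<alpha> A \<longleftrightarrow>
     alpha_monotone \<alpha> A \<and> \<not> (\<exists>B. alpha_monotone \<alpha> B \<and> graph_of A \<subset> graph_of B)"

text \<open>\<open>resolvent \<gamma> A\<close> is \<open>(J + \<gamma> A)\<^sup>-\<^sup>1 J\<close> with \<open>J\<close> the duality mapping:
  \<open>a\<close> is a value at \<open>x\<close> iff \<open>J x \<in> J a + \<gamma> A a\<close>.\<close>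

definition resolvent ::
    "real \<Rightarrow> ('a::real_normed_vector \<Rightarrow> ('a \<Rightarrow>\<^sub>L real) set) \<Rightarrow> 'a \<Rightarrow> 'a set" where
  "resolvent \<gamma> A x =
     {a. duality_map x \<in> {duality_map a + \<gamma> *\<^sub>R u | u. u \<in> A a}}"

end

theory Submission
  imports Defs
begin

text \<open>Uniqueness in the resolvent is strict monotonicity of \<open>J\<close>, and if \<open>J + \<gamma> A\<close> is onto then
  uniqueness applied to an \<open>\<alpha>\<close>-monotone extension of \<open>A\<close> shows that the extension is \<open>A\<close>. For the
  converse, \<open>\<alpha>\<close>-monotonicity of \<open>A\<close> is monotonicity of \<open>A - \<alpha> J\<close>; after rescaling and translation one has
  to find \<open>x\<close> with \<open>-J x \<in> T x\<close> for a maximally monotone \<open>T\<close>. Monotonicity gives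
  \<open>r \<ge> \<langle>y, v\<rangle> \<ge> -\<parallel>(y, v)\<parallel>\<^sup>2 / 2\<close> for all \<open>((y, v), r)\<close> in the convex hull of the points
  \<open>((y, v), \<langle>y, v\<rangle>)\<close>, \<open>(y, v) \<in> gra T\<close>. The Mazur-Orlicz form of the Hahn-Banach theorem inserts an
  affine function between the two sides, and by reflexivity that function is given by a point \<open>(x, f)\<close> of
  \<open>X \<times> X\<^sup>*\<close> with \<open>\<langle>x, f\<rangle> + \<parallel>x\<parallel>\<^sup>2 / 2 + \<parallel>f\<parallel>\<^sup>2 / 2 \<le> \<langle>x - y, f - v\<rangle>\<close> on \<open>gra T\<close>. The left side is
  nonnegative, so \<open>(x, f) \<in> gra T\<close> by maximality, and then \<open>(y, v) = (x, f)\<close> yields \<open>f = -J x\<close>.\<close>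

subsection \<open>The Mazur-Orlicz theorem\<close>


text \<open>One inequality for positive scalars suffices: applied to the inverse scalar it gives
  equality, and \<open>p 0 = 0\<close> follows. This keeps the checks for infima one-sided.\<close>

definition sublinear :: "('a::real_vector \<Rightarrow> real) \<Rightarrow> bool" where
  "sublinear p \<longleftrightarrow> (\<forall>x y. p (x + y) \<le> p x + p y) \<and> (\<forall>t x. 0 < t \<longrightarrow> p (t *\<^sub>R x) \<le> t * p x)"

lemma sublinear_add: "sublinear p \<Longrightarrow> p (x + y) \<le> p x + p y"
  by (simp add: sublinear_def)

lemma sublinear_zero:
  assumes "sublinear p" shows "p 0 = 0"
proof -
  have "p (2 *\<^sub>R 0) \<le> 2 * p 0" "p ((1/2) *\<^sub>R 0) \<le> (1/2) * p 0"
    using assms unfolding sublinear_def by (metis zero_less_numeral, metis half_gt_zero zero_less_one)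
  then show ?thesis by simp
qed

lemma sublinear_scale:
  assumes "sublinear p" "0 \<le> t" shows "p (t *\<^sub>R x) = t * p x"
proof (cases "t = 0")
  case False
  with assms have t: "0 < t" by simp
  have "p (inverse t *\<^sub>R (t *\<^sub>R x)) \<le> inverse t * p (t *\<^sub>R x)"
    using assms t unfolding sublinear_def by (metis inverse_positive_iff_positive)
  then have "t * p x \<le> p (t *\<^sub>R x)"
    using t by (simp add: field_simps)
  moreover have "p (t *\<^sub>R x) \<le> t * p x"
    using assms t by (simp add: sublinear_def)
  ultimately show ?thesis by simp
qed (simp add: sublinear_zero assms)

lemma sublinear_lower: "sublinear p \<Longrightarrow> - p (- x) \<le> p x"
  using sublinear_add[of p x "-x"] sublinear_zero[of p] by simp

text \<open>For a minimal sublinear \<open>S\<close> and \<open>C = {y}\<close>, \<open>\<beta> = S y\<close> this forces \<open>S (- y) = - S y\<close>.\<close>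

lemma sublinear_improve:
  assumes S: "sublinear S" and C: "convex C" "C \<noteq> {}" and \<beta>: "\<And>c. c \<in> C \<Longrightarrow> \<beta> \<le> S c"
  obtains P where "sublinear P" "P \<le> S" "\<And>c. c \<in> C \<Longrightarrow> P (- c) \<le> - \<beta>"
proof -
  \<comment> \<open>This is the largest sublinear function below \<open>S\<close> that is at most
    \<open>- \<beta>\<close> on \<open>- C\<close>. The bound \<open>\<beta> \<le> S c\<close> keeps
    the infimum finite.\<close>
  define P where "P x = (INF (t,c) \<in> {0..} \<times> C. S (x + t *\<^sub>R c) - t * \<beta>)" for x
  have lower: "- S (- x) \<le> S (x + t *\<^sub>R c) - t * \<beta>" if "0 \<le> t" "c \<in> C" for x t c
  proof -
    have "t * \<beta> \<le> t * S c" using \<beta> that by (simp add: mult_left_mono)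
    also have "\<dots> = S ((x + t *\<^sub>R c) + - x)" using sublinear_scale[OF S that(1)] by simp
    also have "\<dots> \<le> S (x + t *\<^sub>R c) + S (- x)" by (rule sublinear_add[OF S])
    finally show ?thesis by simp
  qed
  have bdd: "bdd_below ((\<lambda>(t,c). S (x + t *\<^sub>R c) - t * \<beta>) ` ({0..} \<times> C))" for x
    using lower by (intro bdd_belowI[where m = "- S (- x)"]) auto
  have P_le: "P x \<le> S (x + t *\<^sub>R c) - t * \<beta>" if "0 \<le> t" "c \<in> C" for x t c
    unfolding P_def using cINF_lower[OF bdd, of "(t,c)" x] that by simp
  have le_P: "m \<le> P x" if "\<And>t c. 0 \<le> t \<Longrightarrow> c \<in> C \<Longrightarrow> m \<le> S (x + t *\<^sub>R c) - t * \<beta>" for m x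
    unfolding P_def using that C(2) by (intro cINF_greatest) auto
  have "P (x + y) \<le> P x + P y" for x y
  proof -
    have *: "P (x + y) \<le> (S (x + t *\<^sub>R c) - t * \<beta>) + (S (y + s *\<^sub>R d) - s * \<beta>)"
      if tscd: "0 \<le> t" "0 \<le> s" "c \<in> C" "d \<in> C" for t s c d
    proof -
      \<comment> \<open>Convexity merges two multiples of points of \<open>C\<close> into one
        multiple of a single point, so a sum of two competitors is again a competitor.\<close>
      obtain e where e: "e \<in> C" "(t + s) *\<^sub>R e = t *\<^sub>R c + s *\<^sub>R d"
      proof (cases "t + s = 0")
        case True
        then have "t = 0" "s = 0" using tscd by auto
        then show ?thesis using tscd(3) by (intro that[of c]) auto
      next
        case False
        then have "(t / (t + s)) *\<^sub>R c + (s / (t + s)) *\<^sub>R d \<in> C"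
          using \<open>0 \<le> t\<close> \<open>0 \<le> s\<close> \<open>c \<in> C\<close> \<open>d \<in> C\<close>
          by (intro convexD[OF C(1)]) (auto simp: add_divide_distrib[symmetric])
        moreover have "(t + s) *\<^sub>R ((t / (t + s)) *\<^sub>R c + (s / (t + s)) *\<^sub>R d) = t *\<^sub>R c + s *\<^sub>R d"
          using False by (simp add: scaleR_add_right)
        ultimately show ?thesis using that by blast
      qed
      have "P (x + y) \<le> S ((x + y) + (t + s) *\<^sub>R e) - (t + s) * \<beta>"
        using tscd by (intro P_le e(1)) simp
      also have "(x + y) + (t + s) *\<^sub>R e = (x + t *\<^sub>R c) + (y + s *\<^sub>R d)"
        using e by (simp add: algebra_simps)
      also have "S \<dots> \<le> S (x + t *\<^sub>R c) + S (y + s *\<^sub>R d)" by (rule sublinear_add[OF S])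
      finally show ?thesis by (simp add: algebra_simps)
    qed
    have "P (x + y) - (S (x + t *\<^sub>R c) - t * \<beta>) \<le> P y" if "0 \<le> t" "c \<in> C" for t c
      using *[of t] that by (intro le_P) (simp add: algebra_simps)
    then have "P (x + y) - P y \<le> P x"
      by (intro le_P) (simp add: algebra_simps)
    then show ?thesis by simp
  qed
  moreover have "P (r *\<^sub>R x) \<le> r * P x" if r: "0 < r" for r x
  proof -
    have "P (r *\<^sub>R x) / r \<le> P x"
    proof (rule le_P)
      fix t c assume tc: "0 \<le> (t::real)" "c \<in> C"
      have "P (r *\<^sub>R x) \<le> S (r *\<^sub>R x + (r * t) *\<^sub>R c) - (r * t) * \<beta>"
        using tc r by (intro P_le) auto
      also have "r *\<^sub>R x + (r * t) *\<^sub>R c = r *\<^sub>R (x + t *\<^sub>R c)" by (simp add: algebra_simps)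
      also have "S \<dots> = r * S (x + t *\<^sub>R c)" using r by (intro sublinear_scale[OF S]) simp
      finally show "P (r *\<^sub>R x) / r \<le> S (x + t *\<^sub>R c) - t * \<beta>" using r by (simp add: field_simps)
    qed
    then show ?thesis using r by (simp add: field_simps)
  qed
  ultimately have "sublinear P" by (simp add: sublinear_def)
  moreover have "P \<le> S"
    using C(2) P_le[of 0] by (auto simp: le_fun_def)
  moreover have "P (- c) \<le> - \<beta>" if "c \<in> C" for c
    using P_le[of 1 c "- c"] that sublinear_zero[OF S] by simp
  ultimately show ?thesis using that by blast
qed

text \<open>The common minorant \<open>- S (- x)\<close> keeps the infimum finite. Subadditivity
  needs the chain: the smaller of \<open>f\<close> and \<open>g\<close> serves both
  summands.\<close>

lemma sublinear_INF_chain: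
  assumes S: "\<And>f. f \<in> K \<Longrightarrow> sublinear f \<and> f \<le> S" and "K \<noteq> {}"
    and chain: "\<And>f g. f \<in> K \<Longrightarrow> g \<in> K \<Longrightarrow> f \<le> g \<or> g \<le> f"
  shows "sublinear (\<lambda>x. INF f\<in>K. f x)" "\<And>f. f \<in> K \<Longrightarrow> (\<lambda>x. INF f\<in>K. f x) \<le> f"
proof -
  let ?u = "\<lambda>x. INF f\<in>K. f x"
  have "- S (- x) \<le> f x" if "f \<in> K" for f x
    using S[OF that] sublinear_lower[of f x] by (metis le_funD neg_le_iff_le order_trans)
  then have bdd: "bdd_below ((\<lambda>f. f x) ` K)" for x
    by (intro bdd_belowI[where m = "- S (- x)"]) auto
  have u_le: "?u x \<le> f x" if "f \<in> K" for f x
    using cINF_lower[OF bdd that] .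
  have le_u: "m \<le> ?u x" if "\<And>f. f \<in> K \<Longrightarrow> m \<le> f x" for m x
    using that \<open>K \<noteq> {}\<close> by (intro cINF_greatest) auto
  have "?u (x + y) \<le> ?u x + ?u y" for x y
  proof -
    have *: "?u (x + y) \<le> f x + g y" if fg: "f \<in> K" "g \<in> K" for f g
    proof -
      obtain h where "h \<in> K" "h \<le> f" "h \<le> g" using chain[OF fg] fg by blast
      then show ?thesis
        using u_le[of h "x + y"] sublinear_add[of h x y] S[of h] by (smt (verit) le_funD)
    qed
    have "?u (x + y) - f x \<le> ?u y" if "f \<in> K" for f
      using *[OF that] by (intro le_u) (simp add: algebra_simps)
    then have "?u (x + y) - ?u y \<le> ?u x"
      by (intro le_u) (simp add: algebra_simps)
    then show ?thesis by simp
  qed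
  moreover have "?u (t *\<^sub>R x) \<le> t * ?u x" if t: "0 < t" for t x
  proof -
    have "?u (t *\<^sub>R x) / t \<le> ?u x"
    proof (rule le_u)
      fix f assume f: "f \<in> K"
      have "?u (t *\<^sub>R x) \<le> t * f x"
        using u_le[OF f, of "t *\<^sub>R x"] sublinear_scale[of f t x] S[OF f] t by simp
      then show "?u (t *\<^sub>R x) / t \<le> f x" using t by (simp add: field_simps)
    qed
    then show ?thesis using t by (simp add: field_simps)
  qed
  ultimately show "sublinear ?u" by (simp add: sublinear_def)
  show "?u \<le> f" if "f \<in> K" for f
    using u_le[OF that] by (simp add: le_fun_def)
qed

lemma minimal_sublinear:
  assumes "sublinear S"
  obtains m where "sublinear m" "m \<le> S" "\<And>p. sublinear p \<Longrightarrow> p \<le> m \<Longrightarrow> p = m"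
proof -
  let ?F = "{p. sublinear p \<and> p \<le> S}"
  have "\<exists>m\<in>?F. \<forall>p\<in>?F. p \<le> m \<longrightarrow> p = m"
  \<comment> \<open>Zorn's lemma yields maximal elements, so the pointwise order is
    reversed.\<close>
  proof (rule predicate_Zorn[where P = "\<lambda>f g. g \<le> f"])
    show "partial_order_on ?F (relation_of (\<lambda>f g. g \<le> f) ?F)"
      by (rule partial_order_on_relation_ofI) auto
    fix K assume K: "K \<in> Chains (relation_of (\<lambda>f g. g \<le> f) ?F)"
    then have F: "K \<subseteq> ?F" by (auto simp: Chains_def relation_of_def)
    have chain: "f \<le> g \<or> g \<le> f" if "f \<in> K" "g \<in> K" for f g
      using K that by (auto simp: Chains_def relation_of_def)
    show "\<exists>u\<in>?F. \<forall>f\<in>K. u \<le> f"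
    proof (cases "K = {}")
      case False
      let ?u = "\<lambda>x. INF f\<in>K. f x"
      have u: "sublinear ?u" "\<And>f. f \<in> K \<Longrightarrow> ?u \<le> f"
        using sublinear_INF_chain[of K S] F False chain by auto
      obtain f where "f \<in> K" using False by blast
      then have "?u \<le> S" using u(2)[of f] F by (auto intro: order_trans)
      then show ?thesis using u by blast
    qed (use assms in auto)
  qed
  then show ?thesis using that by (auto intro: order_trans)
qed

text \<open>Minimality makes \<open>m\<close> odd; oddness turns subadditivity into additivity and
  extends homogeneity to negative scalars.\<close>

lemma minimal_sublinear_linear:
  assumes m: "sublinear m" and min: "\<And>p. sublinear p \<Longrightarrow> p \<le> m \<Longrightarrow> p = m"
  shows "linear m"
proof -
  have odd: "m (- y) = - m y" for y
  proof -
    obtain P where P: "sublinear P" "P \<le> m" "P (- y) \<le> - m y"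
      using sublinear_improve[OF m, of "{y}" "m y"] by auto
    then have "m (- y) \<le> - m y" using min by blast
    then show ?thesis using sublinear_lower[OF m, of y] by simp
  qed
  have "m (x + y) = m x + m y" for x y
    using sublinear_add[OF m, of x y] sublinear_add[OF m, of "- x" "- y"] odd[of x] odd[of y] odd[of "x + y"]
    by (simp add: minus_add_distrib)
  moreover have "m (t *\<^sub>R x) = t * m x" for t x
    using sublinear_scale[OF m, of t x] sublinear_scale[OF m, of "- t" x] odd[of "t *\<^sub>R x"]
    by (cases "0 \<le> t") auto
  ultimately show ?thesis by (intro linearI) auto
qed

text \<open>After one improvement of \<open>S\<close> to \<open>P\<close>, any minimal sublinear
  \<open>L\<close> below \<open>P\<close> is linear, and \<open>L (- c) \<le> - \<beta>\<close>
  becomes the required lower bound.\<close>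

theorem mazur_orlicz:
  assumes "sublinear S" "convex C" "C \<noteq> {}" "\<And>c. c \<in> C \<Longrightarrow> \<beta> \<le> S c"
  obtains L where "linear L" "\<And>x. L x \<le> S x" "\<And>c. c \<in> C \<Longrightarrow> \<beta> \<le> L c"
proof -
  obtain P where P: "sublinear P" "P \<le> S" "\<And>c. c \<in> C \<Longrightarrow> P (- c) \<le> - \<beta>"
    using sublinear_improve[OF assms] by blast
  obtain L where L: "sublinear L" "L \<le> P" "\<And>p. sublinear p \<Longrightarrow> p \<le> L \<Longrightarrow> p = L"
    using minimal_sublinear[OF P(1)] by blast
  have lin: "linear L" using minimal_sublinear_linear L by blast
  show ?thesis
  proof
    show "L x \<le> S x" for x using L(2) P(2) by (metis le_funD order_trans)
    show "\<beta> \<le> L c" if "c \<in> C" for c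
      using P(3)[OF that] le_funD[OF L(2), of "- c"] linear_neg[OF lin, of c] by simp
  qed (fact lin)
qed

section \<open>Bounded functionals and norm attainment of functionals\<close>

lemma linear_le_norm_blinfun:
  fixes L :: "'a::real_normed_vector \<Rightarrow> real"
  assumes L: "linear L" and le: "\<And>x. L x \<le> M * norm x"
  obtains f where "\<And>x. blinfun_apply f x = L x"
proof -
  have "\<bar>L x\<bar> \<le> norm x * M" for x
    using le[of x] le[of "- x"] linear_neg[OF L, of x] by (simp add: abs_le_iff mult.commute)
  then have "bounded_linear L"
    using L by (auto intro!: bounded_linear_intro simp: linear_add linear_cmul)
  then show ?thesis using that[of "Blinfun L"] by (simp add: bounded_linear_Blinfun_apply)
qed

text \<open>Mazur-Orlicz with the norm as majorant and a singleton as convex set;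
  \<open>x = 0\<close> needs no separate treatment.\<close>

lemma norming_functional:
  fixes x :: "'a::real_normed_vector"
  obtains f :: "'a \<Rightarrow>\<^sub>L real" where "norm f \<le> 1" "blinfun_apply f x = norm x"
proof -
  have "sublinear (norm :: 'a \<Rightarrow> real)"
    by (auto simp: sublinear_def norm_triangle_ineq)
  then obtain L where L: "linear L" "\<And>y. L y \<le> norm (y::'a)" "norm x \<le> L x"
    using mazur_orlicz[of norm "{x}" "norm x"] by auto
  obtain f where f: "\<And>y. blinfun_apply f y = L y"
    using linear_le_norm_blinfun[of L 1] L by auto
  have "norm f \<le> 1"
    using L(2) L(2)[of "- y" for y] linear_neg[OF L(1)]
    by (intro norm_blinfun_bound) (auto simp: f abs_le_iff)
  then show ?thesis using that[of f] f L(2)[of x] L(3) by simp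
qed

subsection \<open>The duality mapping\<close>


text \<open>A norming functional of \<open>f\<close> in the bidual is evaluation at a point of norm
  at most 1, where \<open>f\<close> attains its norm; that point is rescaled by
  \<open>norm f\<close>.\<close>

lemma reflexive_dual_attained:
  fixes f :: "'a::real_normed_vector \<Rightarrow>\<^sub>L real"
  assumes "reflexive_space TYPE('a)"
  obtains x where "blinfun_apply f x = (norm f)\<^sup>2" "norm x = norm f"
proof -
  obtain \<phi> :: "('a \<Rightarrow>\<^sub>L real) \<Rightarrow>\<^sub>L real" where \<phi>: "norm \<phi> \<le> 1" "blinfun_apply \<phi> f = norm f"
    using norming_functional[of f] by blast
  obtain x where x: "\<And>g. blinfun_apply \<phi> g = blinfun_apply g x"
    using assms unfolding reflexive_space_def by blast
  obtain g :: "'a \<Rightarrow>\<^sub>L real" where g: "norm g \<le> 1" "blinfun_apply g x = norm x"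
    using norming_functional[of x] by blast
  have "norm x \<le> norm \<phi> * norm g"
    using norm_blinfun[of \<phi> g] by (simp add: x g)
  also have "\<dots> \<le> 1" using \<phi>(1) g(1) by (simp add: mult_le_one)
  finally have x_le: "norm x \<le> 1" .
  have fx: "blinfun_apply f x = norm f" using \<phi>(2) x by simp
  \<comment> \<open>Only this product is claimed, because \<open>x\<close> need not be a unit vector
    when \<open>f = 0\<close>.\<close>
  have "norm f = norm f * norm x"
    using norm_blinfun[of f x] x_le fx mult_left_le[of "norm x" "norm f"] by simp
  then have "norm (norm f *\<^sub>R x) = norm f" by simp
  moreover have "blinfun_apply f (norm f *\<^sub>R x) = (norm f)\<^sup>2"
    using fx by (simp add: blinfun.scaleR_right power2_eq_square)
  ultimately show ?thesis using that by blast
qed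

text \<open>A support functional lies below the difference quotient of the norm for
  \<open>t > 0\<close> and above it for \<open>t < 0\<close>, so the two-sided limit determines its
  values.\<close>

lemma smooth_support_unique:
  fixes f g :: "'a::real_normed_vector \<Rightarrow>\<^sub>L real"
  assumes smooth: "smooth_space TYPE('a)" and x: "norm x = 1"
    and f: "norm f \<le> 1" "blinfun_apply f x = 1" and g: "norm g \<le> 1" "blinfun_apply g x = 1"
  shows "f = g"
proof (rule blinfun_eqI)
  fix y :: 'a
  show "blinfun_apply f y = blinfun_apply g y"
  proof (cases "y = 0")
    case False
    define e where "e = y /\<^sub>R norm y"
    have "norm e = 1" using False by (simp add: e_def)
    then obtain l where l: "((\<lambda>t. (norm (x + t *\<^sub>R e) - norm x) / t) \<longlongrightarrow> l) (at (0::real))"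
      using smooth x unfolding smooth_space_def by blast
    have "blinfun_apply h e = l" if h: "norm h \<le> 1" "blinfun_apply h x = 1" for h
    proof (rule antisym)
      have *: "t * blinfun_apply h e \<le> norm (x + t *\<^sub>R e) - norm x" for t
      proof -
        have "blinfun_apply h (x + t *\<^sub>R e) \<le> norm h * norm (x + t *\<^sub>R e)"
          using norm_blinfun[of h "x + t *\<^sub>R e"] by simp
        also have "\<dots> \<le> norm (x + t *\<^sub>R e)" using h(1) by (simp add: mult_left_le_one_le)
        finally show ?thesis using h(2) x by (simp add: blinfun.add_right blinfun.scaleR_right)
      qed
      have "eventually (\<lambda>t. blinfun_apply h e \<le> (norm (x + t *\<^sub>R e) - norm x) / t) (at_right (0::real))"
        using *  by (auto simp: eventually_at_filter field_simps)
      then show "blinfun_apply h e \<le> l"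
        using l by (intro tendsto_lowerbound[of _ l "at_right 0"]) (auto simp: filterlim_at_split)
      have "eventually (\<lambda>t. (norm (x + t *\<^sub>R e) - norm x) / t \<le> blinfun_apply h e) (at_left (0::real))"
        using *  by (auto simp: eventually_at_filter field_simps)
      then show "l \<le> blinfun_apply h e"
        using l by (intro tendsto_upperbound[of _ l "at_left 0"]) (auto simp: filterlim_at_split)
    qed
    then have "blinfun_apply f e = blinfun_apply g e" using f g by simp
    then show ?thesis using False by (simp add: e_def blinfun.scaleR_right)
  qed simp
qed

lemma smooth_duality_unique:
  fixes f g :: "'a::real_normed_vector \<Rightarrow>\<^sub>L real"
  assumes smooth: "smooth_space TYPE('a)"
    and f: "blinfun_apply f x = (norm x)\<^sup>2" "norm f = norm x"
    and g: "blinfun_apply g x = (norm x)\<^sup>2" "norm g = norm x"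
  shows "f = g"
proof (cases "x = 0")
  case False
  have "f /\<^sub>R norm x = g /\<^sub>R norm x"
    by (rule smooth_support_unique[OF smooth, of "x /\<^sub>R norm x"])
      (use False f g in \<open>auto simp: blinfun.scaleR_left blinfun.scaleR_right power2_eq_square field_simps\<close>)
  then show ?thesis using False by simp
qed (use f g in auto)

lemma duality_map_eqI:
  fixes f :: "'a::real_normed_vector \<Rightarrow>\<^sub>L real"
  assumes smooth: "smooth_space TYPE('a)"
    and f: "blinfun_apply f x = (norm x)\<^sup>2" "norm f = norm x"
  shows "duality_map x = f"
  unfolding duality_map_def
proof (rule the_equality)
  fix g :: "'a \<Rightarrow>\<^sub>L real"
  assume g: "blinfun_apply g x = (norm x)\<^sup>2 \<and> (norm x)\<^sup>2 = (norm g)\<^sup>2"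
  then have "norm g = norm x" by (simp add: power2_eq_iff_nonneg)
  then show "g = f" using g by (intro smooth_duality_unique[OF smooth _ _ f]) auto
qed (simp add: f)

text \<open>A norming functional scaled by \<open>norm x\<close> supplies the existence that the
  description operator in \<open>duality_map\<close> relies on.\<close>

lemma duality_map:
  fixes x :: "'a::real_normed_vector"
  assumes smooth: "smooth_space TYPE('a)"
  shows "blinfun_apply (duality_map x) x = (norm x)\<^sup>2" "norm (duality_map x) = norm x"
proof -
  obtain f :: "'a \<Rightarrow>\<^sub>L real" where f: "norm f \<le> 1" "blinfun_apply f x = norm x"
    using norming_functional[of x] by blast
  have "norm x \<le> norm f * norm x" using norm_blinfun[of f x] f by simp
  then have "norm x * norm f = norm x"
    using f(1) mult_left_le[of "norm f" "norm x"] by (simp add: mult.commute)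
  then have "duality_map x = norm x *\<^sub>R f"
    using f by (intro duality_map_eqI[OF smooth]) (auto simp: blinfun.scaleR_left power2_eq_square)
  then show "blinfun_apply (duality_map x) x = (norm x)\<^sup>2" "norm (duality_map x) = norm x"
    using f \<open>norm x * norm f = norm x\<close> by (auto simp: blinfun.scaleR_left power2_eq_square)
qed

lemma duality_map_surj:
  assumes "smooth_space TYPE('a::real_normed_vector)" "reflexive_space TYPE('a)"
  shows "surj (duality_map :: 'a \<Rightarrow> _)"
proof -
  have "\<exists>x. f = duality_map x" for f :: "'a \<Rightarrow>\<^sub>L real"
  proof -
    obtain x where "blinfun_apply f x = (norm f)\<^sup>2" "norm x = norm f"
      using reflexive_dual_attained[OF assms(2)] by blast
    then have "duality_map x = f" by (intro duality_map_eqI[OF assms(1)]) auto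
    then show ?thesis by blast
  qed
  then show ?thesis by (simp add: surj_def)
qed

lemma blinfun_apply_le:
  fixes f :: "'a::real_normed_vector \<Rightarrow>\<^sub>L real"
  shows "blinfun_apply f x \<le> norm f * norm x"
  using norm_blinfun[of f x] by simp

text \<open>All three summands are nonnegative: a square and two defects in
  \<open>blinfun_apply_le\<close>. Vanishing of the left side therefore forces each of them to
  vanish.\<close>

lemma duality_map_diff:
  fixes x y :: "'a::real_normed_vector"
  assumes "smooth_space TYPE('a)"
  shows "blinfun_apply (duality_map x - duality_map y) (x - y) =
    (norm x - norm y)\<^sup>2 + (norm x * norm y - blinfun_apply (duality_map x) y)
      + (norm x * norm y - blinfun_apply (duality_map y) x)"
  by (simp add: blinfun.diff_left blinfun.diff_right duality_map(1)[OF assms] power2_diff)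

text \<open>The vanishing summands give equal norms and make \<open>y\<close> and \<open>x\<close>
  extremal for the same functional. It is then extremal at the normalized midpoint too, against
  strict convexity.\<close>

lemma duality_map_strictly_monotone:
  fixes x y :: "'a::real_normed_vector"
  assumes smooth: "smooth_space TYPE('a)" and convex: "strictly_convex_space TYPE('a)"
    and "blinfun_apply (duality_map x - duality_map y) (x - y) \<le> 0"
  shows "x = y"
proof (rule ccontr)
  assume "x \<noteq> y"
  have le: "blinfun_apply (duality_map a) b \<le> norm a * norm b" for a b :: 'a
    using blinfun_apply_le[of "duality_map a" b] duality_map(2)[OF smooth, of a] by simp
  have "norm x = norm y" and Jyx: "blinfun_apply (duality_map y) x = norm x * norm y"
    using assms(3) le[of x y] le[of y x] duality_map_diff[OF smooth, of x y]
      zero_le_power2[of "norm x - norm y"]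
    by (smt (verit) mult.commute power2_eq_iff_nonneg zero_eq_power2)+
  define \<rho> where "\<rho> = norm y"
  have \<rho>: "0 < \<rho>" "norm x = \<rho>" "norm y = \<rho>"
    using \<open>x \<noteq> y\<close> \<open>norm x = norm y\<close> by (auto simp: \<rho>_def)
  have "norm ((1/2) *\<^sub>R (x /\<^sub>R \<rho> + y /\<^sub>R \<rho>)) < 1"
    using convex \<open>x \<noteq> y\<close> \<rho> unfolding strictly_convex_space_def by simp
  then have "\<rho> * norm ((1/2) *\<^sub>R (x /\<^sub>R \<rho> + y /\<^sub>R \<rho>)) < \<rho>" using \<rho>(1) by simp
  moreover have "blinfun_apply (duality_map y) ((1/2) *\<^sub>R (x /\<^sub>R \<rho> + y /\<^sub>R \<rho>)) = \<rho>"
    using \<rho> Jyx duality_map(1)[OF smooth, of y]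
    by (simp add: blinfun.add_right blinfun.scaleR_right power2_eq_square)
  ultimately show False using le[of y "(1/2) *\<^sub>R (x /\<^sub>R \<rho> + y /\<^sub>R \<rho>)"] \<rho> by simp
qed

subsection \<open>Surjectivity for maximal monotone operators\<close>


text \<open>The pairing is not convex, but the symmetric expression \<open>?B p q\<close> is affine in each argument:
  its nonnegativity passes from \<open>G\<close> to the hull first in \<open>p\<close>, then in \<open>q\<close>, and \<open>p = q\<close> gives the claim.\<close>

lemma monotone_hull_pairing_le:
  fixes G :: "('a::real_normed_vector \<times> ('a \<Rightarrow>\<^sub>L real)) set"
  assumes mono: "\<And>y v y' v'. (y, v) \<in> G \<Longrightarrow> (y', v') \<in> G \<Longrightarrow> 0 \<le> blinfun_apply (v - v') (y - y')"
    and C: "C = convex hull ((\<lambda>(y, v). ((y, v), blinfun_apply v y)) ` G)"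
    and "((y, v), r) \<in> C"
  shows "blinfun_apply v y \<le> r"
proof -
  let ?B = "\<lambda>p q :: ('a \<times> ('a \<Rightarrow>\<^sub>L real)) \<times> real.
    snd p + snd q - blinfun_apply (snd (fst q)) (fst (fst p)) - blinfun_apply (snd (fst p)) (fst (fst q))"
  have conv: "convex {p. 0 \<le> ?B p q}" for q
  proof (rule convexI)
    fix p p' :: "('a \<times> ('a \<Rightarrow>\<^sub>L real)) \<times> real" and t u :: real
    assume p: "p \<in> {p. 0 \<le> ?B p q}" "p' \<in> {p. 0 \<le> ?B p q}" and tu: "0 \<le> t" "0 \<le> u" "t + u = 1"
    have "0 \<le> t * ?B p q + u * ?B p' q"
      using p tu by (intro add_nonneg_nonneg mult_nonneg_nonneg) auto
    \<comment> \<open>\<open>?B\<close> is affine rather than linear in \<open>p\<close>; the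
      correction by \<open>snd q\<close> vanishes since the weights sum to 1.\<close>
    also have "\<dots> = ?B (t *\<^sub>R p + u *\<^sub>R p') q - (1 - (t + u)) * snd q"
      by (simp add: blinfun.add_right blinfun.add_left blinfun.scaleR_left blinfun.scaleR_right algebra_simps)
    finally show "t *\<^sub>R p + u *\<^sub>R p' \<in> {p. 0 \<le> ?B p q}"
      using tu(3) by simp
  qed
  have *: "0 \<le> ?B ((y, v), r) ((y', v'), blinfun_apply v' y')" if G': "(y', v') \<in> G" for y' v'
  proof -
    have "C \<subseteq> {p. 0 \<le> ?B p ((y', v'), blinfun_apply v' y')}"
      unfolding C
    proof (intro hull_minimal conv image_subsetI)
      fix x assume "x \<in> G"
      then show "(case x of (y, v) \<Rightarrow> ((y, v), blinfun_apply v y))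
          \<in> {p. 0 \<le> ?B p ((y', v'), blinfun_apply v' y')}"
        using mono[OF G', of "fst x" "snd x"]
        by (simp add: case_prod_beta blinfun.diff_left blinfun.diff_right)
    qed
    then show ?thesis using assms(3) by blast
  qed
  have "C \<subseteq> {p. 0 \<le> ?B p ((y, v), r)}"
    unfolding C
  proof (intro hull_minimal conv image_subsetI)
    fix x assume "x \<in> G"
    then show "(case x of (y, v) \<Rightarrow> ((y, v), blinfun_apply v y)) \<in> {p. 0 \<le> ?B p ((y, v), r)}"
      using *[of "fst x" "snd x"] by (simp add: case_prod_beta algebra_simps)
  qed
  then have "0 \<le> ?B ((y, v), r) ((y, v), r)" using assms(3) by blast
  then show ?thesis by simp
qed


text \<open>Each point \<open>(w, r)\<close> admits the values \<open>M\<close> of a compact interval around \<open>norm w\<close> of radius \<open>d (w, r)\<close>;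
  convexity makes these intervals intersect pairwise, so the supremum of their left ends lies in all of them.\<close>

lemma convex_quadratic_slope:
  fixes C :: "('z::real_normed_vector \<times> real) set"
  assumes C: "convex C" "C \<noteq> {}" and bound: "\<And>w r. (w, r) \<in> C \<Longrightarrow> 0 \<le> (norm w)\<^sup>2 + 2 * r"
  obtains M where "0 \<le> M" "\<And>w r. (w, r) \<in> C \<Longrightarrow> M\<^sup>2 / 2 \<le> M * norm w + r"
proof -
  \<comment> \<open>Completing the square, the goal for \<open>M\<close> says that \<open>M\<close>
    is within \<open>d (w, r)\<close> of \<open>norm w\<close>.\<close>
  define d where "d = (\<lambda>(w::'z, r). sqrt ((norm w)\<^sup>2 + 2 * r))"
  have d: "0 \<le> d (w, r)" "(d (w, r))\<^sup>2 = (norm w)\<^sup>2 + 2 * r" if "(w, r) \<in> C" for w r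
    using bound[OF that] by (auto simp: d_def)
  have cross: "norm w - d (w, r) \<le> norm z + d (z, s)" if wz: "(w, r) \<in> C" "(z, s) \<in> C" for w r z s
  proof (rule ccontr)
    define g where "g = norm w - norm z"
    \<comment> \<open>Half of the gap between two disjoint intervals is added to each radius, so
      that \<open>D\<close> and \<open>E\<close> are positive, exceed the radii strictly and sum to
      \<open>g\<close>.\<close>
    define \<epsilon> where "\<epsilon> = (g - d (w, r) - d (z, s)) / 2"
    define D E where "D = d (w, r) + \<epsilon>" and "E = d (z, s) + \<epsilon>"
    assume "\<not> norm w - d (w, r) \<le> norm z + d (z, s)"
    then have "0 < \<epsilon>" by (simp add: \<epsilon>_def g_def)
    have DE: "d (w, r) < D" "d (z, s) < E" "0 < D" "0 < E"
      using d(1) wz \<open>0 < \<epsilon>\<close> by (auto simp: D_def E_def add_nonneg_pos)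
    have "D + E = g" by (simp add: D_def E_def \<epsilon>_def)
    have sq: "(norm w)\<^sup>2 + 2 * r < D\<^sup>2" "(norm z)\<^sup>2 + 2 * s < E\<^sup>2"
      using d wz DE(1,2) by (metis power_strict_mono zero_less_numeral)+
    have "0 < g" using DE \<open>D + E = g\<close> by simp
    \<comment> \<open>With these weights \<open>t * D\<^sup>2 + u * E\<^sup>2\<close> equals
      \<open>t * u * g\<^sup>2\<close>, so the estimate below ends at exactly 0.\<close>
    define t u where "t = E / g" and "u = D / g"
    have tu: "0 < t" "0 < u" "t + u = 1" "t * g = E" "u * g = D"
      using DE \<open>0 < g\<close> \<open>D + E = g\<close> by (auto simp: t_def u_def add_divide_distrib[symmetric])
    have "t *\<^sub>R (w, r) + u *\<^sub>R (z, s) \<in> C"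
      using tu wz by (intro convexD[OF C(1)]) auto
    then have "0 \<le> (norm (t *\<^sub>R w + u *\<^sub>R z))\<^sup>2 + 2 * (t * r + u * s)"
      by (intro bound) simp
    also have "norm (t *\<^sub>R w + u *\<^sub>R z) \<le> t * norm w + u * norm z"
      using norm_triangle_ineq[of "t *\<^sub>R w" "u *\<^sub>R z"] tu by simp
    then have "(norm (t *\<^sub>R w + u *\<^sub>R z))\<^sup>2 + 2 * (t * r + u * s)
        \<le> (t * norm w + u * norm z)\<^sup>2 + t * (2 * r) + u * (2 * s)"
      by (simp add: power_mono algebra_simps)
    also have "\<dots> < (t * norm w + u * norm z)\<^sup>2 + t * (D\<^sup>2 - (norm w)\<^sup>2) + u * (E\<^sup>2 - (norm z)\<^sup>2)"
      using sq tu by (intro add_less_le_mono add_strict_left_mono add_strict_mono mult_strict_left_mono mult_left_mono) auto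
    also have "\<dots> = t * D\<^sup>2 + u * E\<^sup>2 - t * u * g\<^sup>2"
    proof -
      have "u = 1 - t" using tu(3) by simp
      then show ?thesis unfolding g_def \<open>u = 1 - t\<close> by (simp add: power2_eq_square algebra_simps)
    qed
    also have "\<dots> = 0"
      using tu(3) by (simp add: tu(4,5)[symmetric] power2_eq_square) algebra
    finally show False by simp
  qed
  \<comment> \<open>Inserting 0 ensures \<open>0 \<le> M\<close>; it does not violate the upper
    bounds, which are nonnegative.\<close>
  define I where "I = insert 0 ((\<lambda>(w, r). norm w - d (w, r)) ` C)"
  define M where "M = Sup I"
  have I_le: "i \<le> norm z + d (z, s)" if "i \<in> I" "(z, s) \<in> C" for i z s
    using that cross d(1) by (auto simp: I_def add_nonneg_nonneg)
  obtain w\<^sub>0 r\<^sub>0 where "(w\<^sub>0, r\<^sub>0) \<in> C" using C(2) by auto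
  then have bdd: "bdd_above I"
    using I_le by (intro bdd_aboveI) blast
  show ?thesis
  proof
    show "0 \<le> M" unfolding M_def using bdd by (intro cSup_upper) (auto simp: I_def)
    fix w r assume wr: "(w, r) \<in> C"
    have "M \<le> norm w + d (w, r)" unfolding M_def
      using I_le wr by (intro cSup_least) (auto simp: I_def)
    moreover have "norm w - d (w, r) \<le> M" unfolding M_def
      using bdd wr by (intro cSup_upper) (auto simp: I_def intro!: rev_image_eqI)
    ultimately have "(M - norm w)\<^sup>2 \<le> (d (w, r))\<^sup>2"
      using d(1)[OF wr] by (simp add: abs_le_iff flip: abs_le_square_iff)
    then show "M\<^sup>2 / 2 \<le> M * norm w + r"
      using d(2)[OF wr] by (simp add: power2_diff)
  qed
qed


text \<open>The slope \<open>M\<close> replaces the bound \<open>- (norm w)\<^sup>2 / 2\<close> by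
  its tangent in \<open>norm w\<close>, which makes the majorant sublinear. The functional from
  Mazur-Orlicz splits into \<open>a\<close> and, by reflexivity, a point \<open>b\<close>; its norm
  is at most \<open>M\<close>.\<close>

lemma fitzpatrick_separation:
  fixes G :: "('a::real_normed_vector \<times> ('a \<Rightarrow>\<^sub>L real)) set"
  assumes smooth: "smooth_space TYPE('a)" and refl: "reflexive_space TYPE('a)"
    and mono: "\<And>y v y' v'. (y, v) \<in> G \<Longrightarrow> (y', v') \<in> G \<Longrightarrow> 0 \<le> blinfun_apply (v - v') (y - y')"
  obtains x f where "\<forall>(y, v)\<in>G.
    blinfun_apply f x + (norm x)\<^sup>2 / 2 + (norm f)\<^sup>2 / 2 \<le> blinfun_apply (f - v) (x - y)"
proof (cases "G = {}")
  case False
  define C where "C = convex hull ((\<lambda>(y, v). ((y, v), blinfun_apply v y)) ` G)"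
  have C: "convex C" "C \<noteq> {}" using False by (auto simp: C_def)
  have "0 \<le> (norm w)\<^sup>2 + 2 * r" if "(w, r) \<in> C" for w r
  proof -
    obtain y v where w: "w = (y, v)" by (cases w)
    have "- (norm v * norm y) \<le> blinfun_apply v y"
      using norm_blinfun[of v y] by simp
    also have "\<dots> \<le> r"
      using monotone_hull_pairing_le[OF mono C_def] that w by simp
    finally have "0 \<le> (norm y - norm v)\<^sup>2 + 2 * (norm v * norm y + r)" by simp
    then show ?thesis by (simp add: w norm_Pair power2_diff)
  qed
  then obtain M where M: "0 \<le> M" "\<And>w r. (w, r) \<in> C \<Longrightarrow> M\<^sup>2 / 2 \<le> M * norm w + r"
    using convex_quadratic_slope[OF C] by blast
  let ?S = "\<lambda>p :: ('a \<times> ('a \<Rightarrow>\<^sub>L real)) \<times> real. M * norm (fst p) + snd p"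
  have S: "sublinear ?S"
    unfolding sublinear_def
  proof (intro conjI allI impI)
    fix p q :: "('a \<times> ('a \<Rightarrow>\<^sub>L real)) \<times> real"
    show "?S (p + q) \<le> ?S p + ?S q"
      using mult_left_mono[OF norm_triangle_ineq M(1), of "fst p" "fst q"] by (simp add: distrib_left)
  qed (simp add: algebra_simps)
  have "M\<^sup>2 / 2 \<le> ?S c" if "c \<in> C" for c
    using M(2)[of "fst c" "snd c"] that by simp
  then obtain L where L: "linear L" "\<And>p. L p \<le> ?S p" "\<And>c. c \<in> C \<Longrightarrow> M\<^sup>2 / 2 \<le> L c"
    using mazur_orlicz[OF S C] by metis
  \<comment> \<open>On the real axis \<open>?S\<close> is itself linear, so domination at both signs
    fixes \<open>L\<close> there.\<close>
  have L_real: "L (0, r) = r" for r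
    using L(2)[of "(0, r)"] L(2)[of "- (0, r)"] linear_neg[OF L(1), of "(0, r)"] by simp
  have L_split: "L ((y, v), r) = L ((y, 0), 0) + L ((0, v), 0) + r" for y v r
    using linear_add[OF L(1), of "((y, 0), 0)" "((0, v), 0)"]
      linear_add[OF L(1), of "((y, v), 0)" "(0, r)"] L_real[of r] by simp
  have "linear (\<lambda>y. L ((y, 0), 0))"
    using linear_add[OF L(1), of "((a, 0), 0)" "((b, 0), 0)" for a b]
      linear_cmul[OF L(1), of _ "((a, 0), 0)" for a]
    by (intro linearI) auto
  then obtain a where a: "\<And>y. blinfun_apply a y = L ((y, 0), 0)"
    using linear_le_norm_blinfun[of "\<lambda>y. L ((y, 0), 0)" M] L(2)[of "((y, 0), 0)" for y]
    by (auto simp: norm_Pair)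
  have "linear (\<lambda>v. L ((0, v), 0))"
    using linear_add[OF L(1), of "((0, v), 0)" "((0, w), 0)" for v w]
      linear_cmul[OF L(1), of _ "((0, v), 0)" for v]
    by (intro linearI) auto
  then obtain \<phi> where \<phi>: "\<And>v. blinfun_apply \<phi> v = L ((0, v), 0)"
    using linear_le_norm_blinfun[of "\<lambda>v. L ((0, v), 0)" M] L(2)[of "((0, v), 0)" for v]
    by (auto simp: norm_Pair)
  obtain b where b: "\<And>v. blinfun_apply \<phi> v = blinfun_apply v b"
    using refl unfolding reflexive_space_def by blast
  have L_eq: "L ((y, v), r) = blinfun_apply a y + blinfun_apply v b + r" for y v r
    unfolding a b[symmetric] \<phi> by (rule L_split)
  define N where "N = (norm a)\<^sup>2 + (norm b)\<^sup>2"
  have "N \<le> M\<^sup>2"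
  proof -
    \<comment> \<open>At the pair of \<open>y\<close> and \<open>duality_map b\<close>,
      \<open>L\<close> takes the value \<open>N\<close>, while the pair has norm
      \<open>sqrt N\<close>.\<close>
    obtain y where y: "blinfun_apply a y = (norm a)\<^sup>2" "norm y = norm a"
      using reflexive_dual_attained[OF refl] by blast
    have "N \<le> M * sqrt N"
      using L(2)[of "((y, duality_map b), 0)"] y duality_map[OF smooth, of b]
      by (simp add: L_eq norm_Pair N_def)
    moreover have N: "0 \<le> N" by (simp add: N_def)
    ultimately have "sqrt N * sqrt N \<le> M * sqrt N" by simp
    then have "sqrt N \<le> M" using M(1) N mult_right_le_imp_le[of "sqrt N" "sqrt N" M]
      by (cases "N = 0") auto
    then show ?thesis using N by (simp add: sqrt_le_D)
  qed
  show ?thesis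
  \<comment> \<open>With these signs the term \<open>blinfun_apply a b\<close> occurs on both sides
    and cancels, leaving the bound by \<open>N / 2\<close>.\<close>
  proof (rule that[of "- a" "- b"], clarify)
    fix y v assume "(y, v) \<in> G"
    then have "((y, v), blinfun_apply v y) \<in> C"
      unfolding C_def by (intro hull_inc) (auto intro: rev_image_eqI)
    then have "M\<^sup>2 / 2 \<le> blinfun_apply a y + blinfun_apply v b + blinfun_apply v y"
      using L(3) unfolding L_eq[symmetric] by blast
    then have "N / 2 \<le> blinfun_apply a y + blinfun_apply v b + blinfun_apply v y"
      using \<open>N \<le> M\<^sup>2\<close> by linarith
    then show "blinfun_apply (- a) (- b) + (norm (- b))\<^sup>2 / 2 + (norm (- a))\<^sup>2 / 2
        \<le> blinfun_apply (- a - v) (- b - y)"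
      by (simp add: N_def blinfun.diff_left blinfun.diff_right blinfun.minus_left blinfun.minus_right add_divide_distrib)
  qed
qed (use that[of 0 0] in simp)

lemma maximal_monotone_meets_minus_duality:
  fixes G :: "('a::real_normed_vector \<times> ('a \<Rightarrow>\<^sub>L real)) set"
  assumes smooth: "smooth_space TYPE('a)" and refl: "reflexive_space TYPE('a)"
    and mono: "\<And>y v y' v'. (y, v) \<in> G \<Longrightarrow> (y', v') \<in> G \<Longrightarrow> 0 \<le> blinfun_apply (v - v') (y - y')"
    and maximal: "\<And>x f. (\<And>y v. (y, v) \<in> G \<Longrightarrow> 0 \<le> blinfun_apply (f - v) (x - y)) \<Longrightarrow> (x, f) \<in> G"
  obtains x where "(x, - duality_map x) \<in> G"
proof -
  obtain x f where "\<forall>(y, v)\<in>G.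
    blinfun_apply f x + (norm x)\<^sup>2 / 2 + (norm f)\<^sup>2 / 2 \<le> blinfun_apply (f - v) (x - y)"
    by (rule fitzpatrick_separation[OF smooth refl mono])
  then have sep: "blinfun_apply f x + (norm x)\<^sup>2 / 2 + (norm f)\<^sup>2 / 2 \<le> blinfun_apply (f - v) (x - y)"
    if "(y, v) \<in> G" for y v
    using that by blast
  have fx: "- (norm f * norm x) \<le> blinfun_apply f x"
    using norm_blinfun[of f x] by simp
  then have "(norm f - norm x)\<^sup>2 / 2 \<le> blinfun_apply f x + (norm x)\<^sup>2 / 2 + (norm f)\<^sup>2 / 2"
    by (simp add: power2_diff field_simps)
  then have sep': "(norm f - norm x)\<^sup>2 / 2 \<le> blinfun_apply (f - v) (x - y)" if "(y, v) \<in> G" for y v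
    using sep[OF that] by linarith
  have "0 \<le> blinfun_apply (f - v) (x - y)" if "(y, v) \<in> G" for y v
    using sep'[OF that] zero_le_power2[of "norm f - norm x"] by linarith
  then have G: "(x, f) \<in> G" by (rule maximal)
  have "norm f = norm x" using sep'[OF G] by simp
  then have "blinfun_apply f x = - (norm x)\<^sup>2"
    using sep[OF G] fx by (simp add: power2_eq_square)
  then have "duality_map x = - f"
    using \<open>norm f = norm x\<close> by (intro duality_map_eqI[OF smooth]) (auto simp: blinfun.minus_left)
  then show ?thesis using that[of x] G by simp
qed

section \<open>Maximal \<alpha>-monotonicity and the resolvent equation\<close>

text \<open>Adjoining the single pair \<open>(x, f)\<close> keeps \<alpha>-monotonicity, so
  maximality among operators becomes a pointwise criterion.\<close>

lemma maximally_alpha_monotone_mem: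
  assumes A: "maximally_alpha_monotone \<alpha> A"
    and x: "\<And>y v. v \<in> A y \<Longrightarrow> \<alpha> * blinfun_apply (duality_map x - duality_map y) (x - y)
      \<le> blinfun_apply (f - v) (x - y)"
  shows "f \<in> A x"
proof (rule ccontr)
  assume "f \<notin> A x"
  define B where "B = A(x := insert f (A x))"
  have graph: "graph_of B = insert (x, f) (graph_of A)"
    by (auto simp: graph_of_def B_def split: if_splits)
  have swap: "blinfun_apply (u - v) (a - b) = blinfun_apply (v - u) (b - a)"
    for u v :: "'a \<Rightarrow>\<^sub>L real" and a b :: 'a
    by (simp add: blinfun.diff_left blinfun.diff_right)
  have x': "\<alpha> * blinfun_apply (duality_map y - duality_map x) (y - x)
      \<le> blinfun_apply (v - f) (y - x)" if "v \<in> A y" for y v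
    using x[OF that] unfolding swap[of v f] swap[of "duality_map y"] .
  have "alpha_monotone \<alpha> B"
    using A x x' unfolding maximally_alpha_monotone_def alpha_monotone_def graph
    by (auto simp: graph_of_def)
  moreover have "graph_of A \<subset> graph_of B"
    using \<open>f \<notin> A x\<close> unfolding graph by (auto simp: graph_of_def)
  ultimately show False using A unfolding maximally_alpha_monotone_def by blast
qed

text \<open>Pairing the difference of the two equations with \<open>a - b\<close> turns
  \<alpha>-monotonicity into \<open>(1 + \<gamma> * \<alpha>) * ?m \<le> 0\<close>, and strict
  monotonicity of J applies. The second conclusion serves the maximality argument.\<close>

lemma resolvent_unique:
  fixes A :: "'a::real_normed_vector \<Rightarrow> ('a \<Rightarrow>\<^sub>L real) set"
  assumes smooth: "smooth_space TYPE('a)" and convex: "strictly_convex_space TYPE('a)"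
    and A: "alpha_monotone \<alpha> A" and \<gamma>: "0 < \<gamma>" "0 < 1 + \<gamma> * \<alpha>"
    and "u \<in> A a" "v \<in> A b"
    and eq: "duality_map a + \<gamma> *\<^sub>R u = duality_map b + \<gamma> *\<^sub>R v"
  shows "a = b" "u = v"
proof -
  let ?m = "blinfun_apply (duality_map a - duality_map b) (a - b)"
  have "\<alpha> * ?m \<le> blinfun_apply (u - v) (a - b)"
    using A assms(6,7) unfolding alpha_monotone_def graph_of_def by auto
  then have "\<gamma> * (\<alpha> * ?m) \<le> \<gamma> * blinfun_apply (u - v) (a - b)"
    using \<gamma>(1) by simp
  moreover have "\<gamma> *\<^sub>R (u - v) = - (duality_map a - duality_map b)"
    using eq by (simp add: algebra_simps)
  then have "\<gamma> * blinfun_apply (u - v) (a - b) = - ?m"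
    by (metis blinfun.minus_left blinfun.scaleR_left real_scaleR_def)
  ultimately have "(1 + \<gamma> * \<alpha>) * ?m \<le> 0" by (simp add: algebra_simps)
  then have "?m \<le> 0" using \<gamma>(2) by (simp add: mult_le_0_iff)
  then show "a = b" using duality_map_strictly_monotone[OF smooth convex] by blast
  then show "u = v" using eq \<gamma>(1) by simp
qed

text \<open>The equation for \<open>g\<close> is equivalent to
  \<open>T a u = - duality_map a\<close>. Since \<open>\<gamma> / \<delta>\<close> is positive,
  \<open>T_nonneg\<close> carries both monotonicity and maximality from \<open>A\<close> to
  \<open>G\<close>.\<close>

lemma resolvent_surj_of_maximal:
  fixes A :: "'a::real_normed_vector \<Rightarrow> ('a \<Rightarrow>\<^sub>L real) set"
  assumes smooth: "smooth_space TYPE('a)" and refl: "reflexive_space TYPE('a)"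
    and A: "maximally_alpha_monotone \<alpha> A" and \<gamma>: "0 < \<gamma>" "0 < 1 + \<gamma> * \<alpha>"
  obtains a u where "u \<in> A a" "g = duality_map a + \<gamma> *\<^sub>R u"
proof -
  define \<delta> where "\<delta> = 1 + \<gamma> * \<alpha>"
  define T where "T a u = (1 / \<delta>) *\<^sub>R (\<gamma> *\<^sub>R (u - \<alpha> *\<^sub>R duality_map a) - g)" for a u
  define G where "G = {(a, T a u) | a u. u \<in> A a}"
  have T_diff: "blinfun_apply (T a u - T b v) (a - b) = \<gamma> / \<delta> *
    (blinfun_apply (u - v) (a - b) - \<alpha> * blinfun_apply (duality_map a - duality_map b) (a - b))" for a u b v
  proof -
    have "T a u - T b v = (\<gamma> / \<delta>) *\<^sub>R ((u - v) - \<alpha> *\<^sub>R (duality_map a - duality_map b))"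
      by (simp add: T_def algebra_simps)
    then show ?thesis by (simp add: blinfun.diff_left blinfun.scaleR_left)
  qed
  have pos: "0 < \<gamma> / \<delta>" using \<gamma> by (simp add: \<delta>_def)
  have T_nonneg: "0 \<le> blinfun_apply (T a u - T b v) (a - b) \<longleftrightarrow>
    \<alpha> * blinfun_apply (duality_map a - duality_map b) (a - b) \<le> blinfun_apply (u - v) (a - b)" for a u b v
    unfolding T_diff using mult_le_cancel_left_pos[OF pos, of 0] by (metis diff_ge_0_iff_ge mult_zero_right)
  obtain x where "(x, - duality_map x) \<in> G"
  proof (rule maximal_monotone_meets_minus_duality[OF smooth refl, of G])
    fix y v y' v' assume "(y, v) \<in> G" "(y', v') \<in> G"
    then show "0 \<le> blinfun_apply (v - v') (y - y')"
      using A unfolding G_def maximally_alpha_monotone_def alpha_monotone_def graph_of_def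
      by (auto simp: T_nonneg)
  next
    fix x f assume *: "\<And>y v. (y, v) \<in> G \<Longrightarrow> 0 \<le> blinfun_apply (f - v) (x - y)"
    \<comment> \<open>This is the solution of \<open>T x u = f\<close>.\<close>
    define u where "u = (1 / \<gamma>) *\<^sub>R (\<delta> *\<^sub>R f + g) + \<alpha> *\<^sub>R duality_map x"
    have f: "f = T x u" using \<gamma> by (simp add: T_def u_def \<delta>_def)
    have "u \<in> A x"
      using * by (intro maximally_alpha_monotone_mem[OF A]) (auto simp: f G_def T_nonneg[symmetric])
    then show "(x, f) \<in> G" using f by (auto simp: G_def)
  qed
  then obtain u where u: "u \<in> A x" "T x u = - duality_map x" by (auto simp: G_def)
  have "\<delta> *\<^sub>R T x u = \<gamma> *\<^sub>R (u - \<alpha> *\<^sub>R duality_map x) - g"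
    using \<gamma>(2) by (simp add: T_def \<delta>_def)
  then have "g = duality_map x + \<gamma> *\<^sub>R u"
    unfolding u(2) by (simp add: \<delta>_def algebra_simps)
  then show ?thesis using u(1) that by blast
qed

theorem proposition3p17:
  fixes A :: "'a::banach \<Rightarrow> ('a \<Rightarrow>\<^sub>L real) set"
    and \<alpha> \<gamma> :: real
  assumes "smooth_space TYPE('a)"
    and "strictly_convex_space TYPE('a)"
    and "reflexive_space TYPE('a)"
    and "alpha_monotone \<alpha> A"
    and "\<gamma> > 0"
    and "1 + \<gamma> * \<alpha> > 0"
  shows "single_valued_op (resolvent \<gamma> A) \<and>
         (domain_of (resolvent \<gamma> A) = UNIV \<longleftrightarrow> maximally_alpha_monotone \<alpha> A)"
proof (intro conjI iffI)
  show "single_valued_op (resolvent \<gamma> A)"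
    unfolding single_valued_op_def
  proof
    fix x assume "x \<in> domain_of (resolvent \<gamma> A)"
    then obtain a where "a \<in> resolvent \<gamma> A x" by (auto simp: domain_of_def)
    moreover have "a = b" if ab: "a \<in> resolvent \<gamma> A x" "b \<in> resolvent \<gamma> A x" for a b
    proof -
      obtain u v where "u \<in> A a" "duality_map x = duality_map a + \<gamma> *\<^sub>R u"
        "v \<in> A b" "duality_map x = duality_map b + \<gamma> *\<^sub>R v"
        using ab unfolding resolvent_def by blast
      then show ?thesis using resolvent_unique(1)[OF assms(1,2,4,5,6)] by metis
    qed
    ultimately show "\<exists>!a. a \<in> resolvent \<gamma> A x" by blast
  qed
next
  assume dom: "domain_of (resolvent \<gamma> A) = UNIV"
  have "graph_of B \<subseteq> graph_of A" if B: "alpha_monotone \<alpha> B" "graph_of A \<subseteq> graph_of B" for B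
  proof clarify
    fix x u assume "(x, u) \<in> graph_of B"
    then have u: "u \<in> B x" by (simp add: graph_of_def)
    \<comment> \<open>The point \<open>z\<close> is chosen so that \<open>x\<close> is a resolvent
      value of \<open>B\<close> at \<open>z\<close>; the domain assumption supplies a value coming
      from \<open>A\<close> at the same \<open>z\<close>.\<close>
    obtain z where z: "duality_map z = duality_map x + \<gamma> *\<^sub>R u"
      using duality_map_surj[OF assms(1,3)] by (metis surjD)
    have "z \<in> domain_of (resolvent \<gamma> A)" using dom by simp
    then obtain a v where v: "v \<in> A a" "duality_map z = duality_map a + \<gamma> *\<^sub>R v"
      by (auto simp: domain_of_def resolvent_def)
    have "v \<in> B a" using v(1) B(2) by (auto simp: graph_of_def)
    \<comment> \<open>Uniqueness is applied to \<open>B\<close>, which contains both pairs.\<close>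
    then have "x = a" "u = v"
      using resolvent_unique[OF assms(1,2) B(1) assms(5,6) u] v(2) z by auto
    then show "(x, u) \<in> graph_of A" using v(1) by (simp add: graph_of_def)
  qed
  then show "maximally_alpha_monotone \<alpha> A"
    using assms(4) unfolding maximally_alpha_monotone_def by blast
next
  assume A: "maximally_alpha_monotone \<alpha> A"
  have "x \<in> domain_of (resolvent \<gamma> A)" for x
  proof -
    obtain a u where "u \<in> A a" "duality_map x = duality_map a + \<gamma> *\<^sub>R u"
      by (rule resolvent_surj_of_maximal[OF assms(1,3) A assms(5,6)])
    then show ?thesis by (auto simp: domain_of_def resolvent_def)
  qed
  then show "domain_of (resolvent \<gamma> A) = UNIV" by blast
qed

end
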